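(* Let $X\subseteq\mathbb{R}^n$ be a nonempty open set, $C\subseteq\mathbb{R}^m$ a closed pointed convex cone with nonempty interior, $f:X\to\mathbb{R}^m$ locally Lipschitz, $\eta:X\times X\to\mathbb{R}^n$ a mapping, and $e\in\mathbb{R}^m$ with $e>_C 0$. Let $\xi\in X$ and suppose that $-f$ is approximate pseudo $(\eta,e)$-invex of type I at $\xi$ and that $\eta(x,\xi)+\eta(\xi,x)=0$ for all $x\in X$. If $\xi$ is a solution of (WMVVI), then $\xi$ is a local $(\eta,e)$-quasi weak efficient solution of the vector optimization problem (VOP) $\min_{x\in X} f(x)$.
   Context: Ordering: for $u,v\in\mathbb{R}^m$, $u\ge_C v$ (equivalently $v\le_C u$) means $u-v\in C$, and $u>_C v$ (equivalently $v<_C u$) means $u-v\in\operatorname{int} C$. $B(x_0,r)$ is the open ball of center $x_0$ and radius $r$; only points of $X$ are considered, since $f$ and $\eta$ are defined on $X$ and $X\times X$. Clarke's generalized Jacobian of a locally Lipschitz $g:X\to\mathbb{R}^m$ at $x\in X$ is the set of $m\times n$ matrices $\partial g(x)=\operatorname{co}\{\lim_{i\to\infty} Jg(x^{(i)}) : x^{(i)}\to x,\ x^{(i)}\in S\}$, where $\operatorname{co}$ is the convex hull, $S$ is the set of points at which $g$ is differentiable, and $Jg$ is the Jacobian matrix (the limits being those that exist). Approximate pseudo $(\eta,e)$-invexity of type I: a locally Lipschitz $g:X\to\mathbb{R}^m$ has this property at $x_0\in X$ if there is $r>0$ such that for all $x,y\in B(x_0,r)$: if $g(x)-g(y)<_C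 -e\,\|\eta(x,y)\|$, then $A_y\,\eta(x,y)<_C 0$ for all $A_y\in\partial g(y)$. (WMVVI): $\xi\in X$ is a solution of (WMVVI) if there is no $x\in X$ such that $A_x\,\eta(x,\xi)<_C 0$ for all $A_x\in\partial f(x)$. Local $(\eta,e)$-quasi weak efficient solution: $\xi\in X$ is such a solution of (VOP) if there is $r>0$ such that there is no $x\in B(\xi,r)$ satisfying $f(x)+e\,\|\eta(x,\xi)\|<_C f(\xi)$. *)

theory Defs
  imports "HOL-Analysis.Analysis"
begin

text \<open>
  Maps on \<open>X\<close> and on \<open>X \<times> X\<close> are represented by total functions; the definitions below only
  depend on their values at points of \<open>X\<close>, provided that \<open>X\<close> is open.
\<close>

definition pointed :: "'a::real_vector set \<Rightarrow> bool" where
  "pointed C \<longleftrightarrow> C \<inter> uminus ` C = {0}"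

definition cone_less :: "'a::real_normed_vector \<Rightarrow> 'a set \<Rightarrow> 'a \<Rightarrow> bool"
    (\<open>(_/ <\<^bsub>_\<^esub> _)\<close> [51, 0, 51] 50) where
  "u <\<^bsub>C\<^esub> v \<longleftrightarrow> v - u \<in> interior C"

text \<open>The library's \<^const>\<open>local_lipschitz\<close>, without its time parameter.\<close>

definition locally_lipschitz_on :: "'a::metric_space set \<Rightarrow> ('a \<Rightarrow> 'b::metric_space) \<Rightarrow> bool" where
  "locally_lipschitz_on X g \<longleftrightarrow>
     (\<forall>x\<in>X. \<exists>u>0. \<exists>L. L-lipschitz_on (cball x u \<inter> X) g)"

text \<open>
  \<open>X\<close> is meant to be open, so that differentiability of \<open>g : X \<rightarrow> \<real>\<^sup>m\<close> at a point of \<open>X\<close>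
  coincides with that of any total extension.
\<close>

definition clarke_jacobian ::
    "(real^'n) set \<Rightarrow> (real^'n \<Rightarrow> real^'m) \<Rightarrow> real^'n \<Rightarrow> (real^'n^'m) set" where
  "clarke_jacobian X g x = convex hull
     {A. \<exists>s :: nat \<Rightarrow> real^'n.
           (\<forall>i. s i \<in> X \<and> g differentiable at (s i)) \<and> s \<longlonglongrightarrow> x \<and>
           (\<lambda>i. jacobian g (at (s i))) \<longlonglongrightarrow> A}"

definition approx_pseudo_invex_I ::
    "(real^'n) set \<Rightarrow> (real^'m) set \<Rightarrow> (real^'n \<Rightarrow> real^'n \<Rightarrow> real^'n) \<Rightarrow> real^'m \<Rightarrow>
     (real^'n \<Rightarrow> real^'m) \<Rightarrow> real^'n \<Rightarrow> bool" where
  "approx_pseudo_invex_I X C \<eta> e g x\<^sub>0 \<longleftrightarrow>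
     (\<exists>r>0. \<forall>x \<in> X \<inter> ball x\<^sub>0 r. \<forall>y \<in> X \<inter> ball x\<^sub>0 r.
        g x - g y <\<^bsub>C\<^esub> - (norm (\<eta> x y) *\<^sub>R e) \<longrightarrow>
        (\<forall>A \<in> clarke_jacobian X g y. A *v \<eta> x y <\<^bsub>C\<^esub> 0))"

definition WMVVI_solution ::
    "(real^'n) set \<Rightarrow> (real^'m) set \<Rightarrow> (real^'n \<Rightarrow> real^'n \<Rightarrow> real^'n) \<Rightarrow>
     (real^'n \<Rightarrow> real^'m) \<Rightarrow> real^'n \<Rightarrow> bool" where
  "WMVVI_solution X C \<eta> f \<xi> \<longleftrightarrow>
     \<xi> \<in> X \<and> \<not> (\<exists>x\<in>X. \<forall>A \<in> clarke_jacobian X f x. A *v \<eta> x \<xi> <\<^bsub>C\<^esub> 0)"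

definition local_quasi_weak_efficient ::
    "(real^'n) set \<Rightarrow> (real^'m) set \<Rightarrow> (real^'n \<Rightarrow> real^'n \<Rightarrow> real^'n) \<Rightarrow> real^'m \<Rightarrow>
     (real^'n \<Rightarrow> real^'m) \<Rightarrow> real^'n \<Rightarrow> bool" where
  "local_quasi_weak_efficient X C \<eta> e f \<xi> \<longleftrightarrow>
     \<xi> \<in> X \<and>
     (\<exists>r>0. \<not> (\<exists>x \<in> X \<inter> ball \<xi> r. f x + norm (\<eta> x \<xi>) *\<^sub>R e <\<^bsub>C\<^esub> f \<xi>))"

end

theory Submission
  imports Defs
begin

text \<open>
  The point is that swapping the two arguments of \<open>\<eta>\<close> undoes the sign change from \<open>f\<close> to \<open>- f\<close>.
  If \<open>x\<close> near \<open>\<xi>\<close> violates quasi weak efficiency, then the same inequality, read for \<open>- f\<close> at the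
  pair \<open>(\<xi>, x)\<close>, is the premise of invexity, since skew symmetry gives
  \<open>\<parallel>\<eta> \<xi> x\<parallel> = \<parallel>\<eta> x \<xi>\<parallel>\<close>. Invexity then controls \<open>B (\<eta> \<xi> x)\<close> for every \<open>B\<close> in the Jacobian of
  \<open>- f\<close> at \<open>x\<close>. By lemma \<open>uminus_mem_clarke_jacobian\<close> these \<open>B\<close> include all \<open>- A\<close> with \<open>A\<close> in the
  Jacobian of \<open>f\<close>, and \<open>(- A) (\<eta> \<xi> x) = A (\<eta> x \<xi>)\<close>, so \<open>x\<close> contradicts (WMVVI).
\<close>

lemma jacobian_uminus:
  fixes g :: "real^'n \<Rightarrow> real^'m"
  assumes "g differentiable at x"
  shows "jacobian (\<lambda>x. - g x) (at x) = - jacobian g (at x)"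
proof -
  have "(g has_derivative frechet_derivative g (at x)) (at x)"
    using assms by (simp add: frechet_derivative_works)
  then have "((\<lambda>x. - g x) has_derivative (\<lambda>h. - frechet_derivative g (at x) h)) (at x)"
    by (rule has_derivative_minus)
  then have "frechet_derivative (\<lambda>x. - g x) (at x) = (\<lambda>h. - frechet_derivative g (at x) h)"
    by (rule frechet_derivative_at [symmetric])
  then show ?thesis
    by (simp add: jacobian_def matrix_def vec_eq_iff)
qed

text \<open>
  Negation maps the limits of Jacobians of \<open>g\<close> to limits of Jacobians of \<open>- g\<close> along the same
  sequences; being linear, it commutes with the convex hull.
\<close>

lemma uminus_mem_clarke_jacobian:
  assumes "A \<in> clarke_jacobian X g x"
  shows "- A \<in> clarke_jacobian X (\<lambda>x. - g x) x"
proof -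
  let ?L = "\<lambda>g. {A. \<exists>s :: nat \<Rightarrow> real^'a.
           (\<forall>i. s i \<in> X \<and> g differentiable at (s i)) \<and> s \<longlonglongrightarrow> x \<and>
           (\<lambda>i. jacobian g (at (s i))) \<longlonglongrightarrow> A}"
  have "uminus ` ?L g \<subseteq> ?L (\<lambda>x. - g x)"
  proof clarify
    fix A s
    assume s: "\<forall>i. s i \<in> X \<and> g differentiable at (s i)" "s \<longlonglongrightarrow> x"
      and lim: "(\<lambda>i. jacobian g (at (s i))) \<longlonglongrightarrow> A"
    have "(\<lambda>i. jacobian (\<lambda>x. - g x) (at (s i))) \<longlonglongrightarrow> - A"
      using tendsto_minus [OF lim] s(1) by (simp add: jacobian_uminus)
    with s show "\<exists>s. (\<forall>i. s i \<in> X \<and> (\<lambda>x. - g x) differentiable at (s i)) \<and> s \<longlonglongrightarrow> x \<and>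
        (\<lambda>i. jacobian (\<lambda>x. - g x) (at (s i))) \<longlonglongrightarrow> - A"
      by (intro exI [of _ s]) (simp add: differentiable_minus)
  qed
  then have "convex hull (uminus ` ?L g) \<subseteq> clarke_jacobian X (\<lambda>x. - g x) x"
    unfolding clarke_jacobian_def by (rule hull_mono)
  moreover have "- A \<in> uminus ` (convex hull ?L g)"
    using assms by (simp add: clarke_jacobian_def)
  ultimately show ?thesis
    by (auto simp: convex_hull_linear_image [OF module_hom_uminus [folded linear_def]])
qed

theorem theorem4p2:
  fixes X :: "(real^'n) set"
    and C :: "(real^'m) set"
    and f :: "real^'n \<Rightarrow> real^'m"
    and \<eta> :: "real^'n \<Rightarrow> real^'n \<Rightarrow> real^'n"
    and e :: "real^'m"
    and \<xi> :: "real^'n"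
  assumes "X \<noteq> {}" and "open X"
    and "closed C" and "pointed C" and "convex_cone C" and "interior C \<noteq> {}"
    and "locally_lipschitz_on X f"
    and "0 <\<^bsub>C\<^esub> e"
    and "\<xi> \<in> X"
    and "approx_pseudo_invex_I X C \<eta> e (\<lambda>x. - f x) \<xi>"
    and "\<And>x. x \<in> X \<Longrightarrow> \<eta> x \<xi> + \<eta> \<xi> x = 0"
    and "WMVVI_solution X C \<eta> f \<xi>"
  shows "local_quasi_weak_efficient X C \<eta> e f \<xi>"
proof -
  obtain r where "r > 0" and invex: "\<And>x y A. \<lbrakk>x \<in> X \<inter> ball \<xi> r; y \<in> X \<inter> ball \<xi> r;
      - f x - - f y <\<^bsub>C\<^esub> - (norm (\<eta> x y) *\<^sub>R e); A \<in> clarke_jacobian X (\<lambda>x. - f x) y\<rbrakk>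
      \<Longrightarrow> A *v \<eta> x y <\<^bsub>C\<^esub> 0"
    using \<open>approx_pseudo_invex_I X C \<eta> e (\<lambda>x. - f x) \<xi>\<close>
    unfolding approx_pseudo_invex_I_def by blast
  have False if x: "x \<in> X \<inter> ball \<xi> r" and better: "f x + norm (\<eta> x \<xi>) *\<^sub>R e <\<^bsub>C\<^esub> f \<xi>" for x
  proof -
    have skew: "\<eta> \<xi> x = - \<eta> x \<xi>"
      using assms(11) x by (metis IntD1 minus_unique)
    have premise: "- f \<xi> - - f x <\<^bsub>C\<^esub> - (norm (\<eta> \<xi> x) *\<^sub>R e)"
      using better by (simp add: cone_less_def skew algebra_simps)
    have "A *v \<eta> x \<xi> <\<^bsub>C\<^esub> 0" if "A \<in> clarke_jacobian X f x" for A
    proof -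
      have "(- A) *v \<eta> \<xi> x <\<^bsub>C\<^esub> 0"
        using invex [OF _ x premise uminus_mem_clarke_jacobian [OF that]] \<open>\<xi> \<in> X\<close> \<open>r > 0\<close> by simp
      moreover have "(- A) *v \<eta> \<xi> x = A *v \<eta> x \<xi>"
        by (simp add: skew matrix_vector_mult_def vec_eq_iff)
      ultimately show ?thesis by simp
    qed
    then show False
      using \<open>WMVVI_solution X C \<eta> f \<xi>\<close> x unfolding WMVVI_solution_def by blast
  qed
  then show ?thesis
    using \<open>\<xi> \<in> X\<close> \<open>r > 0\<close> unfolding local_quasi_weak_efficient_def by blast
qed

end
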